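(* Let $\mathcal{A}\in\mathbb{C}^{I_1\times\cdots\times I_M\times J_1\times\cdots\times J_N}$, and let $\mathcal{M}\in\mathbb{C}^{I_1\times\cdots\times I_M\times I_1\times\cdots\times I_M}$ and $\mathcal{N}\in\mathbb{C}^{J_1\times\cdots\times J_N\times J_1\times\cdots\times J_N}$ be Hermitian positive definite tensors. Then $$(\mathcal{A}*_N\mathcal{A}^{\dagger}_{\mathcal{M}\mathcal{N}})^{\#}_{\mathcal{M}\mathcal{M}}=\mathcal{A}*_N\mathcal{A}^{\dagger}_{\mathcal{M}\mathcal{N}}.$$
   Context: For $\mathcal{A}\in\mathbb{C}^{I_1\times\cdots\times I_M\times J_1\times\cdots\times J_N}$ and $\mathcal{B}\in\mathbb{C}^{J_1\times\cdots\times J_N\times K_1\times\cdots\times K_L}$ the Einstein product $*_N$ (contracting $N$ indices) is $(\mathcal{A}*_N\mathcal{B})_{i_1\cdots i_Mk_1\cdots k_L}=\sum_{j_1,\dots,j_N}a_{i_1\cdots i_Mj_1\cdots j_N}b_{j_1\cdots j_Nk_1\cdots k_L}$; $*_M,*_K$ are defined likewise. The conjugate transpose is $(\mathcal{A}^H)_{j_1\cdots j_Ni_1\cdots i_M}=\overline{a_{i_1\cdots i_Mj_1\cdots j_N}}$. In $\mathbb{C}^{I_1\times\cdots\times I_K\times I_1\times\cdots\times I_K}$: the identity tensor $\mathcal{I}$ has entries $\prod_k\delta_{i_kj_k}$; $\mathcal{U}$ is unitary if $\mathcal{U}*_K\mathcal{U}^H=\mathcal{U}^H*_K\mathcal{U}=\mathcal{I}$;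 $\mathcal{D}$ is diagonal if $d_{i_1\cdots i_Kj_1\cdots j_K}=0$ whenever $(i_1,\dots,i_K)\ne(j_1,\dots,j_K)$; $\mathcal{P}$ is Hermitian positive definite if $\mathcal{P}=\mathcal{U}*_K\mathcal{D}*_K\mathcal{U}^H$ with $\mathcal{U}$ unitary and $\mathcal{D}$ diagonal with positive diagonal entries; $\mathcal{P}^{-1}$ is the inverse with respect to $*_K$. For any $\mathcal{A}\in\mathbb{C}^{I_1\times\cdots\times I_M\times J_1\times\cdots\times J_N}$ and Hermitian positive definite $\mathcal{S}\in\mathbb{C}^{I_1\times\cdots\times I_M\times I_1\times\cdots\times I_M}$, $\mathcal{T}\in\mathbb{C}^{J_1\times\cdots\times J_N\times J_1\times\cdots\times J_N}$: the weighted conjugate transpose is $\mathcal{A}^{\#}_{\mathcal{S}\mathcal{T}}=\mathcal{T}^{-1}*_N\mathcal{A}^H*_M\mathcal{S}$, and the weighted Moore--Penrose inverse $\mathcal{A}^{\dagger}_{\mathcal{S}\mathcal{T}}$ is the unique $\mathcal{X}\in\mathbb{C}^{J_1\times\cdots\times J_N\times I_1\times\cdots\times I_M}$ satisfying $\mathcal{A}*_N\mathcal{X}*_M\mathcal{A}=\mathcal{A}$, $\mathcal{X}*_M\mathcal{A}*_N\mathcal{X}=\mathcal{X}$, $(\mathcal{S}*_M\mathcal{A}*_N\mathcal{X})^H=\mathcal{S}*_M\mathcal{A}*_N\mathcal{X}$, $(\mathcal{T}*_N\mathcal{X}*_M\mathcal{A})^H=\mathcal{T}*_N\mathcal{X}*_M\mathcal{A}$.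 *)

theory Defs
  imports Complex_Main "HOL-Library.FuncSet"
begin

text \<open>
  A tensor of shape \<open>ds = [d\<^sub>1, \<dots>, d\<^sub>p]\<close> is a function on multi-indices, which are lists of
  length \<open>p\<close> with entries counted from 0. The space
  \<open>\<complex>\<^bsup>I\<^sub>1 \<times> \<dots> \<times> I\<^sub>M \<times> J\<^sub>1 \<times> \<dots> \<times> J\<^sub>N\<^esup>\<close> is \<open>tensor_space (Is @ Js)\<close>, and the entry
  \<open>a\<^bsub>i\<^sub>1\<dots>i\<^sub>M j\<^sub>1\<dots>j\<^sub>N\<^esub>\<close> is \<open>A (i @ j)\<close>. Tensors are extensional, so that equality of elements
  of a tensor space is equality of entries. Operations that depend on how the modes are
  grouped take the shapes of the groups as arguments.
\<close>

type_synonym tensor = "nat list \<Rightarrow> complex"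

definition multi_index :: "nat list \<Rightarrow> nat list set" where
  "multi_index ds = {i. length i = length ds \<and> (\<forall>k<length ds. i ! k < ds ! k)}"

definition tensor_space :: "nat list \<Rightarrow> tensor set" where
  "tensor_space ds = multi_index ds \<rightarrow>\<^sub>E UNIV"

text \<open>\<open>einstein_prod Is Js Ks A B\<close> contracts the \<open>length Js\<close> last modes of \<open>A\<close>, of shape
  \<open>Is @ Js\<close>, with the first modes of \<open>B\<close>, of shape \<open>Js @ Ks\<close>.\<close>

definition einstein_prod ::
    "nat list \<Rightarrow> nat list \<Rightarrow> nat list \<Rightarrow> tensor \<Rightarrow> tensor \<Rightarrow> tensor" where
  "einstein_prod Is Js Ks A B =
    (\<lambda>l\<in>multi_index (Is @ Ks).
      \<Sum>j\<in>multi_index Js. A (take (length Is) l @ j) * B (j @ drop (length Is) l))"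

text \<open>Here \<open>A\<close> has shape \<open>Is @ Js\<close> and the result has shape \<open>Js @ Is\<close>.\<close>

definition conj_transpose :: "nat list \<Rightarrow> nat list \<Rightarrow> tensor \<Rightarrow> tensor" where
  "conj_transpose Is Js A =
    (\<lambda>l\<in>multi_index (Js @ Is). cnj (A (drop (length Js) l @ take (length Js) l)))"

definition identity_tensor :: "nat list \<Rightarrow> tensor" where
  "identity_tensor Is =
    (\<lambda>l\<in>multi_index (Is @ Is). \<Prod>k<length Is. if l ! k = l ! (length Is + k) then 1 else 0)"

definition unitary_tensor :: "nat list \<Rightarrow> tensor \<Rightarrow> bool" where
  "unitary_tensor Is U \<longleftrightarrow>
    U \<in> tensor_space (Is @ Is) \<and>
    einstein_prod Is Is Is U (conj_transpose Is Is U) = identity_tensor Is \<and>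
    einstein_prod Is Is Is (conj_transpose Is Is U) U = identity_tensor Is"

definition diagonal_tensor :: "nat list \<Rightarrow> tensor \<Rightarrow> bool" where
  "diagonal_tensor Is D \<longleftrightarrow>
    D \<in> tensor_space (Is @ Is) \<and>
    (\<forall>i\<in>multi_index Is. \<forall>j\<in>multi_index Is. i \<noteq> j \<longrightarrow> D (i @ j) = 0)"

definition hermitian_positive_definite :: "nat list \<Rightarrow> tensor \<Rightarrow> bool" where
  "hermitian_positive_definite Is P \<longleftrightarrow>
    P \<in> tensor_space (Is @ Is) \<and>
    (\<exists>U D. unitary_tensor Is U \<and> diagonal_tensor Is D \<and>
      (\<forall>i\<in>multi_index Is. D (i @ i) \<in> \<real> \<and> 0 < Re (D (i @ i))) \<and>
      P = einstein_prod Is Is Is (einstein_prod Is Is Is U D) (conj_transpose Is Is U))"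

definition tensor_inverse :: "nat list \<Rightarrow> tensor \<Rightarrow> tensor" where
  "tensor_inverse Is P =
    (THE Q. Q \<in> tensor_space (Is @ Is) \<and>
      einstein_prod Is Is Is P Q = identity_tensor Is \<and>
      einstein_prod Is Is Is Q P = identity_tensor Is)"

text \<open>In the next three definitions \<open>A\<close> has shape \<open>Is @ Js\<close>, the weight \<open>S\<close> has shape
  \<open>Is @ Is\<close> and the weight \<open>T\<close> has shape \<open>Js @ Js\<close>.\<close>

definition weighted_conj_transpose ::
    "nat list \<Rightarrow> nat list \<Rightarrow> tensor \<Rightarrow> tensor \<Rightarrow> tensor \<Rightarrow> tensor" where
  "weighted_conj_transpose Is Js S T A =
    einstein_prod Js Is Is
      (einstein_prod Js Js Is (tensor_inverse Js T) (conj_transpose Is Js A)) S"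

definition is_weighted_moore_penrose ::
    "nat list \<Rightarrow> nat list \<Rightarrow> tensor \<Rightarrow> tensor \<Rightarrow> tensor \<Rightarrow> tensor \<Rightarrow> bool" where
  "is_weighted_moore_penrose Is Js S T A X \<longleftrightarrow>
    X \<in> tensor_space (Js @ Is) \<and>
    einstein_prod Is Is Js (einstein_prod Is Js Is A X) A = A \<and>
    einstein_prod Js Js Is (einstein_prod Js Is Js X A) X = X \<and>
    conj_transpose Is Is (einstein_prod Is Js Is (einstein_prod Is Is Js S A) X) =
      einstein_prod Is Js Is (einstein_prod Is Is Js S A) X \<and>
    conj_transpose Js Js (einstein_prod Js Is Js (einstein_prod Js Js Is T X) A) =
      einstein_prod Js Is Js (einstein_prod Js Js Is T X) A"

definition weighted_moore_penrose ::
    "nat list \<Rightarrow> nat list \<Rightarrow> tensor \<Rightarrow> tensor \<Rightarrow> tensor \<Rightarrow> tensor" where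
  "weighted_moore_penrose Is Js S T A = (THE X. is_weighted_moore_penrose Is Js S T A X)"

end

theory Submission
  imports Defs
begin

text \<open>
  Since \<open>M * A * X\<close> is Hermitian for \<open>X = A\<^sup>\<dagger>\<close>, one has \<open>(A * X)\<^sup>H * M = M * A * X\<close>, and
  multiplication by \<open>M\<^sup>-\<^sup>1\<close> gives the claim. The substance is that \<open>A\<^sup>\<dagger>\<close> exists. Put
  \<open>A\<^sup># = N\<^sup>-\<^sup>1 * A\<^sup>H * M\<close> and \<open>B = A\<^sup># * A\<close>, which is self-adjoint for the inner product given by
  \<open>N\<close>. The powers of \<open>B\<close> are linearly dependent over the reals, and definiteness of \<open>N\<close> and \<open>M\<close>
  allows \<open>B\<close> to be cancelled from such a relation until it reads \<open>A = A * B * q(B)\<close> for a real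
  polynomial \<open>q\<close>. Then \<open>X = q(B) * A\<^sup>#\<close> satisfies the four equations.
\<close>

section \<open>Tensor algebra\<close>

lemma finite_multi_index: "finite (multi_index ds)"
proof -
  \<comment> \<open>A crude bound suffices: each entry is below its own dimension, hence below the
    sum of all dimensions, so a multi-index is a list of fixed length over a finite
    alphabet.\<close>
  have "multi_index ds \<subseteq> {xs. set xs \<subseteq> {..<Suc (sum_list ds)} \<and> length xs = length ds}"
  proof
    fix i assume i: "i \<in> multi_index ds"
    have "i ! k < Suc (sum_list ds)" if "k < length ds" for k
      using i that member_le_sum_list[of "ds ! k" ds]
      by (fastforce simp: multi_index_def)
    then show "i \<in> {xs. set xs \<subseteq> {..<Suc (sum_list ds)} \<and> length xs = length ds}"
      using i by (auto simp: multi_index_def in_set_conv_nth)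
  qed
  then show ?thesis
    by (rule finite_subset) (rule finite_lists_length_eq, simp)
qed

lemma length_multi_index: "i \<in> multi_index ds \<Longrightarrow> length i = length ds"
  by (simp add: multi_index_def)

lemma append_in_multi_index:
  assumes "i \<in> multi_index Is" "k \<in> multi_index Ks"
  shows "i @ k \<in> multi_index (Is @ Ks)"
  using assms by (auto simp: multi_index_def nth_append)

lemma multi_index_append_cases:
  assumes "l \<in> multi_index (Is @ Ks)"
  obtains i k where "l = i @ k" "i \<in> multi_index Is" "k \<in> multi_index Ks"
proof
  show "l = take (length Is) l @ drop (length Is) l" by simp
  have n: "\<And>k. k < length Is + length Ks \<Longrightarrow> l ! k < (Is @ Ks) ! k"
    and "length l = length Is + length Ks"
    using assms by (auto simp: multi_index_def)
  moreover have "l ! k < Is ! k" if "k < length Is" for k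
    using n[of k] that by (simp add: nth_append)
  moreover have "l ! (length Is + k) < Ks ! k" if "k < length Ks" for k
    using n[of "length Is + k"] that by (simp add: nth_append)
  ultimately show "take (length Is) l \<in> multi_index Is" "drop (length Is) l \<in> multi_index Ks"
    by (auto simp: multi_index_def)
qed

lemma tensor_eqI:
  assumes "A \<in> tensor_space (Is @ Ks)" "B \<in> tensor_space (Is @ Ks)"
    and "\<And>i k. i \<in> multi_index Is \<Longrightarrow> k \<in> multi_index Ks \<Longrightarrow> A (i @ k) = B (i @ k)"
  shows "A = B"
proof (rule PiE_ext)
  show "A l = B l" if "l \<in> multi_index (Is @ Ks)" for l
    using multi_index_append_cases[OF that] assms(3) by metis
qed (use assms(1,2) in \<open>simp_all add: tensor_space_def\<close>)

lemma einstein_prod_in_space: "einstein_prod Is Js Ks A B \<in> tensor_space (Is @ Ks)"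
  by (simp add: einstein_prod_def tensor_space_def)

lemma conj_transpose_in_space: "conj_transpose Is Js A \<in> tensor_space (Js @ Is)"
  by (simp add: conj_transpose_def tensor_space_def)

lemma identity_in_space: "identity_tensor Is \<in> tensor_space (Is @ Is)"
  by (simp add: identity_tensor_def tensor_space_def)

definition zero_tensor :: "nat list \<Rightarrow> tensor" where
  "zero_tensor ds = (\<lambda>_\<in>multi_index ds. 0)"

lemma zero_in_space: "zero_tensor ds \<in> tensor_space ds"
  by (simp add: zero_tensor_def tensor_space_def)

lemmas in_space_intros =
  einstein_prod_in_space conj_transpose_in_space identity_in_space zero_in_space

lemma einstein_prod_entry:
  assumes "i \<in> multi_index Is" "k \<in> multi_index Ks"
  shows "einstein_prod Is Js Ks A B (i @ k) = (\<Sum>j\<in>multi_index Js. A (i @ j) * B (j @ k))"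
  using assms by (simp add: einstein_prod_def append_in_multi_index length_multi_index)

lemma conj_transpose_entry:
  assumes "i \<in> multi_index Is" "j \<in> multi_index Js"
  shows "conj_transpose Is Js A (j @ i) = cnj (A (i @ j))"
  using assms by (simp add: conj_transpose_def append_in_multi_index length_multi_index)

lemma identity_entry:
  assumes "i \<in> multi_index Is" "j \<in> multi_index Is"
  shows "identity_tensor Is (i @ j) = (if i = j then 1 else 0)"
proof -
  have "identity_tensor Is (i @ j) = (\<Prod>k<length Is. if i ! k = j ! k then 1 else 0)"
    using assms by (simp add: identity_tensor_def append_in_multi_index nth_append
        length_multi_index)
  also have "\<dots> = (if \<forall>k<length Is. i ! k = j ! k then 1 else 0)"
    by (auto intro!: prod_zero)
  also have "\<dots> = (if i = j then 1 else 0)"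
    using assms by (auto simp: list_eq_iff_nth_eq length_multi_index)
  finally show ?thesis .
qed

lemma zero_entry:
  assumes "i \<in> multi_index Is" "j \<in> multi_index Js"
  shows "zero_tensor (Is @ Js) (i @ j) = 0"
  using assms by (simp add: zero_tensor_def append_in_multi_index)

lemmas entry_simps = einstein_prod_entry conj_transpose_entry identity_entry zero_entry

section \<open>Algebraic laws of the Einstein product and the conjugate transpose\<close>

lemma einstein_prod_assoc:
  "einstein_prod Is Ks Ls (einstein_prod Is Js Ks A B) C =
   einstein_prod Is Js Ls A (einstein_prod Js Ks Ls B C)"
proof (rule tensor_eqI[OF einstein_prod_in_space einstein_prod_in_space])
  fix i l assume "i \<in> multi_index Is" "l \<in> multi_index Ls"
  moreover have "(\<Sum>k\<in>multi_index Ks. (\<Sum>j\<in>multi_index Js. A (i @ j) * B (j @ k)) * C (k @ l)) =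
    (\<Sum>j\<in>multi_index Js. A (i @ j) * (\<Sum>k\<in>multi_index Ks. B (j @ k) * C (k @ l)))"
    unfolding sum_distrib_left sum_distrib_right
    by (subst sum.swap) (simp add: mult.assoc)
  ultimately show "einstein_prod Is Ks Ls (einstein_prod Is Js Ks A B) C (i @ l) =
      einstein_prod Is Js Ls A (einstein_prod Js Ks Ls B C) (i @ l)"
    by (simp add: einstein_prod_entry)
qed

lemma conj_transpose_einstein_prod:
  "conj_transpose Is Ks (einstein_prod Is Js Ks A B) =
   einstein_prod Ks Js Is (conj_transpose Js Ks B) (conj_transpose Is Js A)"
  by (rule tensor_eqI[OF conj_transpose_in_space einstein_prod_in_space])
    (simp add: entry_simps mult.commute)

lemma conj_transpose_conj_transpose:
  assumes "A \<in> tensor_space (Is @ Js)"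
  shows "conj_transpose Js Is (conj_transpose Is Js A) = A"
  by (rule tensor_eqI[OF conj_transpose_in_space assms]) (simp add: conj_transpose_entry)

lemma identity_einstein_prod:
  assumes "A \<in> tensor_space (Is @ Js)"
  shows "einstein_prod Is Is Js (identity_tensor Is) A = A"
  by (rule tensor_eqI[OF einstein_prod_in_space assms])
    (simp add: entry_simps finite_multi_index if_distrib[of "\<lambda>x. x * _"] cong: if_cong)

lemma einstein_prod_identity:
  assumes "A \<in> tensor_space (Is @ Js)"
  shows "einstein_prod Is Js Js A (identity_tensor Js) = A"
  by (rule tensor_eqI[OF einstein_prod_in_space assms])
    (simp add: entry_simps finite_multi_index if_distrib[of "\<lambda>x. _ * x"] cong: if_cong)

lemma einstein_prod_zero:
  "einstein_prod Is Js Ks A (zero_tensor (Js @ Ks)) = zero_tensor (Is @ Ks)"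
  by (rule tensor_eqI[OF einstein_prod_in_space zero_in_space]) (simp add: entry_simps)

lemma conj_transpose_identity:
  "conj_transpose Is Is (identity_tensor Is) = identity_tensor Is"
  by (rule tensor_eqI[OF conj_transpose_in_space identity_in_space]) (simp add: entry_simps)

lemma diagonal_einstein_prod_entry:
  assumes D: "diagonal_tensor Is D" and i: "i \<in> multi_index Is" and k: "k \<in> multi_index Ks"
  shows "einstein_prod Is Is Ks D A (i @ k) = D (i @ i) * A (i @ k)"
proof -
  have "einstein_prod Is Is Ks D A (i @ k) =
      (\<Sum>j\<in>multi_index Is. if j = i then D (i @ i) * A (i @ k) else 0)"
    unfolding einstein_prod_entry[OF i k]
    using D i by (intro sum.cong) (auto simp: diagonal_tensor_def)
  then show ?thesis using i by (simp add: finite_multi_index)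
qed

section \<open>Hermitian positive definite tensors\<close>

text \<open>The diagonal factor has real entries and so equals its own conjugate transpose;
  transposing the product \<open>U D U^H\<close> reverses the factors and returns the same
  product.\<close>

lemma hermitian_positive_definite_hermitian:
  assumes "hermitian_positive_definite Is P"
  shows "conj_transpose Is Is P = P"
proof -
  obtain U D where U: "unitary_tensor Is U" and D: "diagonal_tensor Is D"
    and pos: "\<And>i. i \<in> multi_index Is \<Longrightarrow> D (i @ i) \<in> \<real>"
    and P: "P = einstein_prod Is Is Is (einstein_prod Is Is Is U D) (conj_transpose Is Is U)"
    using assms unfolding hermitian_positive_definite_def by blast
  have "conj_transpose Is Is D = D"
  proof (rule tensor_eqI[OF conj_transpose_in_space])
    fix i j assume ij: "i \<in> multi_index Is" "j \<in> multi_index Is"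
    then show "conj_transpose Is Is D (i @ j) = D (i @ j)"
      using D pos[of i] by (cases "i = j")
        (auto simp: conj_transpose_entry diagonal_tensor_def Reals_cnj_iff)
  qed (use D in \<open>simp add: diagonal_tensor_def\<close>)
  then show ?thesis
    using U by (simp add: P conj_transpose_einstein_prod einstein_prod_assoc
        conj_transpose_conj_transpose unitary_tensor_def)
qed

text \<open>Definiteness, for all columns of \<open>Z\<close> at once: the entry of
  \<open>Z^H P Z\<close> at \<open>k @ k\<close> is the quadratic form of \<open>P\<close> at column
  \<open>k\<close>. In the coordinates \<open>W = U^H Z\<close> it is a sum of squares with positive
  weights.\<close>

lemma hermitian_positive_definite_cancel:
  assumes P: "hermitian_positive_definite Is P" and Z: "Z \<in> tensor_space (Is @ Ks)"
    and 0: "einstein_prod Ks Is Ks (conj_transpose Is Ks Z) (einstein_prod Is Is Ks P Z) =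
        zero_tensor (Ks @ Ks)"
  shows "Z = zero_tensor (Is @ Ks)"
proof -
  obtain U D where U: "unitary_tensor Is U" and D: "diagonal_tensor Is D"
    and real: "\<And>i. i \<in> multi_index Is \<Longrightarrow> D (i @ i) \<in> \<real>"
    and pos: "\<And>i. i \<in> multi_index Is \<Longrightarrow> 0 < Re (D (i @ i))"
    and P: "P = einstein_prod Is Is Is (einstein_prod Is Is Is U D) (conj_transpose Is Is U)"
    using P unfolding hermitian_positive_definite_def by blast
  define W where "W = einstein_prod Is Is Ks (conj_transpose Is Is U) Z"
  have UW: "einstein_prod Is Is Ks U W = Z"
    using U by (simp add: W_def einstein_prod_assoc[symmetric] unitary_tensor_def
        identity_einstein_prod[OF Z])
  have "conj_transpose Is Ks W = einstein_prod Ks Is Is (conj_transpose Is Ks Z) U"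
    using U by (simp add: W_def conj_transpose_einstein_prod conj_transpose_conj_transpose
        unitary_tensor_def)
  then have W0: "einstein_prod Ks Is Ks (conj_transpose Is Ks W) (einstein_prod Is Is Ks D W) =
      zero_tensor (Ks @ Ks)"
    using 0 by (simp add: P W_def einstein_prod_assoc)
  have "W = zero_tensor (Is @ Ks)"
  proof (rule tensor_eqI[OF _ zero_in_space])
    show "W \<in> tensor_space (Is @ Ks)" by (simp add: W_def einstein_prod_in_space)
    fix i k assume i: "i \<in> multi_index Is" and k: "k \<in> multi_index Ks"
    \<comment> \<open>Only the diagonal entries of \<open>W^H D W\<close> are inspected; the one at
      \<open>k @ k\<close> involves column \<open>k\<close> of \<open>W\<close> alone.\<close>
    have "0 = einstein_prod Ks Is Ks (conj_transpose Is Ks W) (einstein_prod Is Is Ks D W) (k @ k)"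
      using W0 k by (simp add: zero_entry)
    also have "\<dots> = (\<Sum>i\<in>multi_index Is. cnj (W (i @ k)) * (D (i @ i) * W (i @ k)))"
      using k by (simp add: einstein_prod_entry[of k Ks k] conj_transpose_entry
          diagonal_einstein_prod_entry[OF D])
    also have "\<dots> = (\<Sum>i\<in>multi_index Is. of_real (Re (D (i @ i)) * (cmod (W (i @ k)))\<^sup>2))"
    proof (rule sum.cong[OF refl])
      fix i assume "i \<in> multi_index Is"
      have "cnj (W (i @ k)) * (D (i @ i) * W (i @ k)) =
          D (i @ i) * (W (i @ k) * cnj (W (i @ k)))"
        by (simp add: mult_ac)
      also have "\<dots> = of_real (Re (D (i @ i)) * (cmod (W (i @ k)))\<^sup>2)"
        using real[OF \<open>i \<in> multi_index Is\<close>]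
        by (simp add: complex_norm_square[symmetric])
      finally show "cnj (W (i @ k)) * (D (i @ i) * W (i @ k)) =
          of_real (Re (D (i @ i)) * (cmod (W (i @ k)))\<^sup>2)" .
    qed
    finally have "complex_of_real
        (\<Sum>i\<in>multi_index Is. Re (D (i @ i)) * (cmod (W (i @ k)))\<^sup>2) = of_real 0"
      by (simp only: of_real_sum of_real_0)
    then have "(\<Sum>i\<in>multi_index Is. Re (D (i @ i)) * (cmod (W (i @ k)))\<^sup>2) = 0"
      by (simp only: of_real_eq_iff)
    moreover have "0 \<le> Re (D (i @ i)) * (cmod (W (i @ k)))\<^sup>2" if "i \<in> multi_index Is" for i
      using pos[OF that] by simp
    ultimately have "Re (D (i @ i)) * (cmod (W (i @ k)))\<^sup>2 = 0"
      using i by (meson finite_multi_index sum_nonneg_eq_0_iff)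
    then have "W (i @ k) = 0" using i pos[OF i] by auto
    then show "W (i @ k) = zero_tensor (Is @ Ks) (i @ k)"
      using i k by (simp add: zero_entry)
  qed
  then show ?thesis using UW by (simp add: einstein_prod_zero)
qed

section \<open>Inverses of Hermitian positive definite tensors\<close>

lemma hermitian_positive_definite_invertible:
  assumes "hermitian_positive_definite Is P"
  obtains Q where "Q \<in> tensor_space (Is @ Is)"
    "einstein_prod Is Is Is P Q = identity_tensor Is"
    "einstein_prod Is Is Is Q P = identity_tensor Is"
proof -
  let ?m = "einstein_prod Is Is Is"
  obtain U D where U: "unitary_tensor Is U" and D: "diagonal_tensor Is D"
    and pos: "\<And>i. i \<in> multi_index Is \<Longrightarrow> 0 < Re (D (i @ i))"
    and P: "P = ?m (?m U D) (conj_transpose Is Is U)"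
    using assms unfolding hermitian_positive_definite_def by blast
  \<comment> \<open>The inverse of \<open>P\<close> will be \<open>U E U^H\<close>. Inverting every
    entry of \<open>D\<close> keeps the off-diagonal zeros, because
    \<open>inverse 0 = 0\<close>.\<close>
  define E where "E = (\<lambda>l\<in>multi_index (Is @ Is). inverse (D l))"
  have E: "diagonal_tensor Is E"
    using D by (auto simp: diagonal_tensor_def E_def tensor_space_def append_in_multi_index)
  have entries: "D (i @ i) * E (i @ i) = 1" if "i \<in> multi_index Is" for i
  proof -
    have "D (i @ i) \<noteq> 0" using pos[OF that] by auto
    then show ?thesis using that by (simp add: E_def append_in_multi_index)
  qed
  have off: "D (i @ j) = 0" "E (i @ j) = 0"
    if "i \<in> multi_index Is" "j \<in> multi_index Is" "i \<noteq> j" for i j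
    using D E that by (auto simp: diagonal_tensor_def)
  have "?m D E = identity_tensor Is"
    by (rule tensor_eqI[OF einstein_prod_in_space identity_in_space])
      (auto simp: diagonal_einstein_prod_entry[OF D] identity_entry entries off)
  \<comment> \<open>The trailing factor \<open>V\<close> lets the rule fire inside right-associated
    products. The identity stays on the right-hand side because \<open>V\<close> is arbitrary and
    may lie outside the tensor space.\<close>
  then have DE: "?m D (?m E V) = ?m (identity_tensor Is) V" for V
    by (metis einstein_prod_assoc)
  have "?m E D = identity_tensor Is"
    by (rule tensor_eqI[OF einstein_prod_in_space identity_in_space])
      (auto simp: diagonal_einstein_prod_entry[OF E] identity_entry entries off
        mult.commute[of "E _"])
  then have ED: "?m E (?m D V) = ?m (identity_tensor Is) V" for V
    by (metis einstein_prod_assoc)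
  have UU: "?m U (conj_transpose Is Is U) = identity_tensor Is"
    "?m (conj_transpose Is Is U) (?m U V) = ?m (identity_tensor Is) V" for V
    using U by (simp_all add: unitary_tensor_def flip: einstein_prod_assoc)
  show thesis
  proof
    show "?m (?m U E) (conj_transpose Is Is U) \<in> tensor_space (Is @ Is)"
      by (rule einstein_prod_in_space)
    show "?m P (?m (?m U E) (conj_transpose Is Is U)) = identity_tensor Is"
      "?m (?m (?m U E) (conj_transpose Is Is U)) P = identity_tensor Is"
      by (simp_all add: P einstein_prod_assoc UU DE ED identity_einstein_prod in_space_intros)
  qed
qed

text \<open>The definite description is justified by existence and by
  \<open>R = R (P Q) = (R P) Q = Q\<close> for two-sided inverses \<open>Q\<close> and
  \<open>R\<close>.\<close>

lemma tensor_inverse: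
  assumes "hermitian_positive_definite Is P"
  shows "tensor_inverse Is P \<in> tensor_space (Is @ Is)"
    and "einstein_prod Is Is Is P (tensor_inverse Is P) = identity_tensor Is"
    and "einstein_prod Is Is Is (tensor_inverse Is P) P = identity_tensor Is"
proof -
  let ?m = "einstein_prod Is Is Is"
  obtain Q where Q: "Q \<in> tensor_space (Is @ Is)" "?m P Q = identity_tensor Is"
    "?m Q P = identity_tensor Is"
    using hermitian_positive_definite_invertible[OF assms] .
  have "tensor_inverse Is P = Q"
    unfolding tensor_inverse_def
  proof (rule the_equality)
    fix R assume R: "R \<in> tensor_space (Is @ Is) \<and>
      ?m P R = identity_tensor Is \<and> ?m R P = identity_tensor Is"
    then have "R = ?m R (?m P Q)" by (simp add: Q einstein_prod_identity)
    also have "\<dots> = ?m (?m R P) Q" by (simp only: einstein_prod_assoc)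
    also have "\<dots> = Q" using R Q by (simp add: identity_einstein_prod)
    finally show "R = Q" .
  qed (use Q in simp)
  with Q show "tensor_inverse Is P \<in> tensor_space (Is @ Is)"
    "?m P (tensor_inverse Is P) = identity_tensor Is"
    "?m (tensor_inverse Is P) P = identity_tensor Is" by simp_all
qed

lemma hermitian_positive_definite_left_cancel:
  assumes "hermitian_positive_definite Is P"
    and "X \<in> tensor_space (Is @ Ks)" "Y \<in> tensor_space (Is @ Ks)"
    and "einstein_prod Is Is Ks P X = einstein_prod Is Is Ks P Y"
  shows "X = Y"
proof -
  have "Z = einstein_prod Is Is Ks (tensor_inverse Is P) (einstein_prod Is Is Ks P Z)"
    if "Z \<in> tensor_space (Is @ Ks)" for Z
    by (simp add: tensor_inverse(3)[OF assms(1)] identity_einstein_prod[OF that]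
        flip: einstein_prod_assoc)
  with assms show ?thesis by metis
qed

text \<open>Since \<open>P\<close> is Hermitian, the conjugate transpose of its inverse is again a
  right inverse of \<open>P\<close>; cancelling \<open>P\<close> on the left identifies the
  two.\<close>

lemma tensor_inverse_hermitian:
  assumes P: "hermitian_positive_definite Is P"
  shows "conj_transpose Is Is (tensor_inverse Is P) = tensor_inverse Is P"
proof (rule hermitian_positive_definite_left_cancel[OF P])
  have "einstein_prod Is Is Is P (conj_transpose Is Is (tensor_inverse Is P)) =
      conj_transpose Is Is (einstein_prod Is Is Is (tensor_inverse Is P) P)"
    by (simp add: conj_transpose_einstein_prod hermitian_positive_definite_hermitian[OF P])
  then show "einstein_prod Is Is Is P (conj_transpose Is Is (tensor_inverse Is P)) =
      einstein_prod Is Is Is P (tensor_inverse Is P)"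
    by (simp add: tensor_inverse[OF P] conj_transpose_identity)
qed (auto intro: in_space_intros tensor_inverse[OF P])

section \<open>Real polynomials in a tensor\<close>

text \<open>Gaussian elimination, by induction on the set \<open>S\<close> of equations;
  \<open>T\<close> is the set of unknowns. An equation without nonzero coefficients is dropped, any
  other one is used to eliminate a pivot unknown.\<close>

lemma homogeneous_system_nontrivial_solution:
  fixes f :: "'i \<Rightarrow> 's \<Rightarrow> 'a :: field"
  assumes "finite S" "finite T" "card S < card T"
  shows "\<exists>c. (\<exists>i\<in>T. c i \<noteq> 0) \<and> (\<forall>s\<in>S. (\<Sum>i\<in>T. c i * f i s) = 0)"
  using assms
proof (induction S arbitrary: T f rule: finite_induct)
  case empty
  then obtain i where "i \<in> T" by fastforce
  then show ?case by (intro exI[of _ "\<lambda>_. 1"]) auto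
next
  case (insert s S)
  show ?case
  proof (cases "\<forall>i\<in>T. f i s = 0")
    case True
    then show ?thesis using insert.IH[of T f] insert.prems insert.hyps by auto
  next
    case False
    then obtain p where p: "p \<in> T" "f p s \<noteq> 0" by blast
    let ?T = "T - {p}"
    \<comment> \<open>These are the coefficients after equation \<open>s\<close> has been solved for
      the unknown \<open>p\<close> and substituted into equation \<open>t\<close>.\<close>
    define g where "g i t = f i t - f i s / f p s * f p t" for i t
    have "card S < card ?T" using insert.prems insert.hyps p by auto
    then obtain c where c: "\<exists>i\<in>?T. c i \<noteq> 0" "\<forall>t\<in>S. (\<Sum>i\<in>?T. c i * g i t) = 0"
      using insert.IH[of ?T g] insert.prems by auto
    \<comment> \<open>Back substitution: the value at \<open>p\<close> is chosen to satisfy equation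
      \<open>s\<close>.\<close>
    define d where "d = c(p := - (\<Sum>i\<in>?T. c i * f i s) / f p s)"
    have sum_d: "(\<Sum>i\<in>T. d i * f i t) = d p * f p t + (\<Sum>i\<in>?T. c i * f i t)" for t
      using insert.prems p by (subst sum.remove[of _ p]) (auto simp: d_def intro!: sum.cong)
    have "(\<Sum>i\<in>T. d i * f i t) = (\<Sum>i\<in>?T. c i * g i t)" for t
    proof -
      have "(\<Sum>i\<in>?T. c i * g i t) =
          (\<Sum>i\<in>?T. c i * f i t) - (\<Sum>i\<in>?T. c i * f i s * (f p t / f p s))"
        unfolding sum_subtractf[symmetric] by (simp add: g_def algebra_simps)
      also have "(\<Sum>i\<in>?T. c i * f i s * (f p t / f p s)) = - (d p * f p t)"
        by (simp add: d_def sum_distrib_right sum_divide_distrib)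
      finally show ?thesis by (simp add: sum_d)
    qed
    moreover have "(\<Sum>i\<in>T. d i * f i s) = 0"
      unfolding sum_d using p by (simp add: d_def)
    moreover have "\<exists>i\<in>T. d i \<noteq> 0" using c(1) by (auto simp: d_def)
    ultimately show ?thesis using c(2) by (intro exI[of _ d]) auto
  qed
qed

section \<open>Real linear combinations and powers of tensors\<close>

text \<open>The coefficients are real so that conjugate transposition leaves them fixed; this is how
  a polynomial in a self-adjoint tensor stays self-adjoint.\<close>

definition tensor_lincomb :: "nat list \<Rightarrow> nat \<Rightarrow> (nat \<Rightarrow> real) \<Rightarrow> (nat \<Rightarrow> tensor) \<Rightarrow> tensor" where
  "tensor_lincomb ds n c F = (\<lambda>l\<in>multi_index ds. \<Sum>i<n. of_real (c i) * F i l)"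

lemma tensor_lincomb_in_space: "tensor_lincomb ds n c F \<in> tensor_space ds"
  by (simp add: tensor_lincomb_def tensor_space_def)

lemma tensor_lincomb_entry:
  assumes "i \<in> multi_index Is" "k \<in> multi_index Ks"
  shows "tensor_lincomb (Is @ Ks) n c F (i @ k) = (\<Sum>j<n. of_real (c j) * F j (i @ k))"
  using assms by (simp add: tensor_lincomb_def append_in_multi_index)

lemma einstein_prod_lincomb_right:
  "einstein_prod Is Js Ks A (tensor_lincomb (Js @ Ks) n c F) =
   tensor_lincomb (Is @ Ks) n c (\<lambda>i. einstein_prod Is Js Ks A (F i))"
  by (rule tensor_eqI[OF einstein_prod_in_space tensor_lincomb_in_space],
      simp add: entry_simps tensor_lincomb_entry sum_distrib_left, subst sum.swap)
    (simp add: mult_ac)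

lemma einstein_prod_lincomb_left:
  "einstein_prod Is Js Ks (tensor_lincomb (Is @ Js) n c F) A =
   tensor_lincomb (Is @ Ks) n c (\<lambda>i. einstein_prod Is Js Ks (F i) A)"
  by (rule tensor_eqI[OF einstein_prod_in_space tensor_lincomb_in_space],
      simp add: entry_simps tensor_lincomb_entry sum_distrib_left sum_distrib_right,
      subst sum.swap)
    (simp add: mult_ac)

lemma conj_transpose_lincomb:
  "conj_transpose Is Js (tensor_lincomb (Is @ Js) n c F) =
   tensor_lincomb (Js @ Is) n c (\<lambda>i. conj_transpose Is Js (F i))"
  by (rule tensor_eqI[OF conj_transpose_in_space tensor_lincomb_in_space])
    (simp add: entry_simps tensor_lincomb_entry)

primrec tensor_power :: "nat list \<Rightarrow> tensor \<Rightarrow> nat \<Rightarrow> tensor" where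
  "tensor_power Is B 0 = identity_tensor Is"
| "tensor_power Is B (Suc n) = einstein_prod Is Is Is B (tensor_power Is B n)"

lemma tensor_power_commute:
  assumes "B \<in> tensor_space (Is @ Is)"
  shows "einstein_prod Is Is Is (tensor_power Is B n) B =
    einstein_prod Is Is Is B (tensor_power Is B n)"
  using assms
  by (induction n)
    (simp_all add: identity_einstein_prod einstein_prod_identity einstein_prod_assoc)

lemma tensor_powers_dependent:
  obtains n c where "\<exists>i<n. c i \<noteq> 0"
    "tensor_lincomb (Is @ Is) n c (tensor_power Is B) = zero_tensor (Is @ Is)"
proof -
  \<comment> \<open>A complex tensor equation with real unknowns amounts to two real equations per
    entry, with \<open>True\<close> marking the real part and \<open>False\<close> the imaginary
    part. Taking one power more than there are equations forces a dependence.\<close>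
  let ?S = "multi_index (Is @ Is) \<times> (UNIV :: bool set)"
  define n where "n = Suc (card ?S)"
  define f where "f i = (\<lambda>(l, b). if b then Re (tensor_power Is B i l)
    else Im (tensor_power Is B i l))" for i
  have "finite ?S" by (simp add: finite_multi_index)
  then obtain c :: "nat \<Rightarrow> real" where c: "\<exists>i<n. c i \<noteq> 0"
    "\<forall>s\<in>?S. (\<Sum>i<n. c i * f i s) = 0"
    using homogeneous_system_nontrivial_solution[of ?S "{..<n}" f] by (auto simp: n_def)
  have "(\<Sum>i<n. of_real (c i) * tensor_power Is B i l) = 0" if "l \<in> multi_index (Is @ Is)" for l
    using c(2)[rule_format, of "(l, True)"] c(2)[rule_format, of "(l, False)"] that
    by (simp add: complex_eq_iff f_def)
  then have "tensor_lincomb (Is @ Is) n c (tensor_power Is B) = zero_tensor (Is @ Is)"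
    by (auto simp: tensor_lincomb_def zero_tensor_def restrict_def)
  with c(1) that show thesis by blast
qed

lemma tensor_power_lincomb_shift:
  assumes "c 0 = 0"
  shows "tensor_lincomb (Is @ Is) (Suc n) c (tensor_power Is B) =
    einstein_prod Is Is Is B (tensor_lincomb (Is @ Is) n (\<lambda>i. c (Suc i)) (tensor_power Is B))"
  unfolding einstein_prod_lincomb_right
  unfolding tensor_lincomb_def sum.lessThan_Suc_shift
  by (simp add: assms)

text \<open>For a nonzero polynomial \<open>p\<close> with \<open>B p(B) = 0\<close> and
  \<open>p(0) = 0\<close>, write \<open>p(x) = x r(x)\<close>. Then \<open>B B r(B) = 0\<close>, and
  \<open>cancel\<close> gives the shorter relation \<open>B r(B) = 0\<close>. A nonzero coefficient
  survives each shift, so the descent stops at a nonzero constant term. The leading \<open>B\<close>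
  stays in place because \<open>B\<close> may be singular.\<close>

lemma tensor_power_relation_constant_term:
  assumes cancel: "\<And>Y. Y \<in> tensor_space (Is @ Is) \<Longrightarrow>
      einstein_prod Is Is Is B (einstein_prod Is Is Is B Y) = zero_tensor (Is @ Is) \<Longrightarrow>
      einstein_prod Is Is Is B Y = zero_tensor (Is @ Is)"
    and "\<exists>i<n. c i \<noteq> 0"
    and "einstein_prod Is Is Is B (tensor_lincomb (Is @ Is) n c (tensor_power Is B)) =
      zero_tensor (Is @ Is)"
  shows "\<exists>m d. d 0 \<noteq> 0 \<and>
    einstein_prod Is Is Is B (tensor_lincomb (Is @ Is) (Suc m) d (tensor_power Is B)) =
      zero_tensor (Is @ Is)"
  using assms(2,3)
proof (induction n arbitrary: c)
  case (Suc n)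
  show ?case
  proof (cases "c 0 = 0")
    case False
    then show ?thesis using Suc.prems by blast
  next
    case True
    have "einstein_prod Is Is Is B
        (tensor_lincomb (Is @ Is) n (\<lambda>i. c (Suc i)) (tensor_power Is B)) =
        zero_tensor (Is @ Is)"
      using cancel Suc.prems(2) unfolding tensor_power_lincomb_shift[of c, OF True]
      by (simp add: tensor_lincomb_in_space)
    moreover have "\<exists>i<n. c (Suc i) \<noteq> 0"
      using Suc.prems(1) True by (metis not0_implies_Suc Suc_less_SucD)
    ultimately show ?thesis by (intro Suc.IH)
  qed
qed simp

section \<open>The weighted Moore--Penrose inverse\<close>

lemma weighted_moore_penrose_exists:
  assumes A: "A \<in> tensor_space (Is @ Js)"
    and M: "hermitian_positive_definite Is M" and N: "hermitian_positive_definite Js N"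
  shows "\<exists>X. is_weighted_moore_penrose Is Js M N A X"
proof -
  let ?m = einstein_prod
  note assoc = einstein_prod_assoc
  define Ni where "Ni = tensor_inverse Js N"
  note Ni = tensor_inverse[OF N, folded Ni_def]
  have MH: "conj_transpose Is Is M = M" and NH: "conj_transpose Js Js N = N"
    and NiH: "conj_transpose Js Js Ni = Ni"
    using M N by (simp_all add: Ni_def hermitian_positive_definite_hermitian
        tensor_inverse_hermitian)
  let ?AH = "conj_transpose Is Js A"
  define As where "As = ?m Js Js Is Ni (?m Js Is Is ?AH M)"
  define B where "B = ?m Js Is Js As A"
  have sp: "As \<in> tensor_space (Js @ Is)" "B \<in> tensor_space (Js @ Js)"
    by (simp_all add: As_def B_def in_space_intros)
  have NAs: "?m Js Js Is N As = ?m Js Is Is ?AH M"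
    by (simp add: As_def Ni identity_einstein_prod in_space_intros flip: assoc)
  have NB: "?m Js Js Js N B = ?m Js Is Js ?AH (?m Is Is Js M A)"
    unfolding B_def by (simp add: NAs flip: assoc)
  then have "conj_transpose Js Js (?m Js Js Js N B) = ?m Js Js Js N B"
    by (simp add: conj_transpose_einstein_prod conj_transpose_conj_transpose[OF A] MH assoc)
  \<comment> \<open>This says that \<open>B\<close> is self-adjoint for the inner product given by
    \<open>N\<close>; it follows from \<open>N B = A^H M A\<close>, which is Hermitian.\<close>
  then have BHN: "?m Js Js Js (conj_transpose Js Js B) N = ?m Js Js Js N B"
    by (simp add: conj_transpose_einstein_prod NH)

  let ?zero = "zero_tensor (Js @ Js)"
  \<comment> \<open>By self-adjointness \<open>(B Y)^H N (B Y) = Y^H N B B Y = 0\<close>, and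
    \<open>N\<close> is definite.\<close>
  have cancelB: "?m Js Js Js B Y = ?zero"
    if "?m Js Js Js B (?m Js Js Js B Y) = ?zero" for Y
  proof (rule hermitian_positive_definite_cancel[OF N einstein_prod_in_space])
    have "?m Js Js Js (conj_transpose Js Js (?m Js Js Js B Y)) (?m Js Js Js N (?m Js Js Js B Y)) =
        ?m Js Js Js (conj_transpose Js Js Y)
          (?m Js Js Js (?m Js Js Js (conj_transpose Js Js B) N) (?m Js Js Js B Y))"
      by (simp add: conj_transpose_einstein_prod assoc)
    then show "?m Js Js Js (conj_transpose Js Js (?m Js Js Js B Y))
        (?m Js Js Js N (?m Js Js Js B Y)) = ?zero"
      by (simp add: BHN assoc that einstein_prod_zero)
  qed
  \<comment> \<open>Here \<open>(A Y)^H M (A Y) = Y^H N B Y = 0\<close>, and \<open>M\<close> is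
    definite.\<close>
  have cancelA: "?m Is Js Js A Y = zero_tensor (Is @ Js)"
    if "?m Js Js Js B Y = ?zero" for Y
  proof (rule hermitian_positive_definite_cancel[OF M einstein_prod_in_space])
    have "?m Js Is Js (conj_transpose Is Js (?m Is Js Js A Y)) (?m Is Is Js M (?m Is Js Js A Y)) =
        ?m Js Js Js (conj_transpose Js Js Y) (?m Js Js Js (?m Js Js Js N B) Y)"
      by (simp add: NB conj_transpose_einstein_prod assoc)
    then show "?m Js Is Js (conj_transpose Is Js (?m Is Js Js A Y))
        (?m Is Is Js M (?m Is Js Js A Y)) = ?zero"
      by (simp add: assoc that einstein_prod_zero)
  qed

  obtain n c where "\<exists>i<n. c i \<noteq> 0"
    "tensor_lincomb (Js @ Js) n c (tensor_power Js B) = ?zero"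
    by (rule tensor_powers_dependent)
  \<comment> \<open>The dependence is first multiplied by \<open>B\<close>, which gives it the
    leading factor that the descent requires.\<close>
  then obtain m d where d: "d 0 \<noteq> 0"
    and d_rel: "?m Js Js Js B (tensor_lincomb (Js @ Js) (Suc m) d (tensor_power Js B)) = ?zero"
    using tensor_power_relation_constant_term[of Js B, OF cancelB]
    by (metis einstein_prod_zero)
  have rel: "tensor_lincomb (Is @ Js) (Suc m) d (\<lambda>i. ?m Is Js Js A (tensor_power Js B i)) =
      zero_tensor (Is @ Js)"
    using cancelA[OF d_rel] by (simp only: einstein_prod_lincomb_right)

  \<comment> \<open>With \<open>p\<close> the polynomial with coefficients \<open>d\<close>, the
    choice of \<open>q\<close> makes \<open>p(x) = d 0 * (1 - x q(x))\<close>. Thus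
    \<open>A p(B) = 0\<close> turns into \<open>A = A B q(B)\<close>.\<close>
  define q where
    "q = tensor_lincomb (Js @ Js) m (\<lambda>i. - d (Suc i) / d 0) (tensor_power Js B)"
  have ABq: "?m Is Js Js A (?m Js Js Js B q) = A"
  proof (rule tensor_eqI[OF einstein_prod_in_space A])
    fix i j assume ij: "i \<in> multi_index Is" "j \<in> multi_index Js"
    let ?s = "\<Sum>k<m. of_real (d (Suc k)) *
      ?m Is Js Js A (?m Js Js Js B (tensor_power Js B k)) (i @ j)"
    have "of_real (d 0) * A (i @ j) + ?s = 0"
      using fun_cong[OF rel, of "i @ j"] ij
      by (simp add: tensor_lincomb_entry zero_entry sum.lessThan_Suc_shift
          einstein_prod_identity[OF A] del: sum.lessThan_Suc)
    moreover have "?m Is Js Js A (?m Js Js Js B q) (i @ j) = - ?s / of_real (d 0)"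
      using ij by (simp add: q_def einstein_prod_lincomb_right tensor_lincomb_entry
          sum_divide_distrib sum_negf)
    ultimately have "of_real (d 0) * ?m Is Js Js A (?m Js Js Js B q) (i @ j) =
        of_real (d 0) * A (i @ j)"
      using d by (simp add: add_eq_0_iff2)
    then show "?m Is Js Js A (?m Js Js Js B q) (i @ j) = A (i @ j)"
      using d by simp
  qed
  have q_sp: "q \<in> tensor_space (Js @ Js)"
    by (simp add: q_def tensor_lincomb_in_space)
  have qB: "?m Js Js Js q B = ?m Js Js Js B q"
    by (simp add: q_def einstein_prod_lincomb_left einstein_prod_lincomb_right
        tensor_power_commute[OF sp(2)])
  \<comment> \<open>Self-adjointness with respect to \<open>N\<close> passes from \<open>B\<close>
    to its powers, and then to the real combination \<open>q\<close>.\<close>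
  have "?m Js Js Js (conj_transpose Js Js (tensor_power Js B i)) N =
      ?m Js Js Js N (tensor_power Js B i)" for i
  proof (induction i)
    case 0
    have "N \<in> tensor_space (Js @ Js)" using N by (simp add: hermitian_positive_definite_def)
    then show ?case
      by (simp add: conj_transpose_identity identity_einstein_prod einstein_prod_identity)
  next
    case (Suc i)
    have "?m Js Js Js (conj_transpose Js Js (tensor_power Js B (Suc i))) N =
        ?m Js Js Js (conj_transpose Js Js (tensor_power Js B i)) (?m Js Js Js N B)"
      by (simp add: conj_transpose_einstein_prod assoc BHN)
    also have "\<dots> = ?m Js Js Js N (?m Js Js Js (tensor_power Js B i) B)"
      by (simp add: Suc flip: assoc)
    finally show ?case by (simp add: tensor_power_commute[OF sp(2)])
  qed
  then have qHN: "?m Js Js Js (conj_transpose Js Js q) N = ?m Js Js Js N q"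
    by (simp add: q_def einstein_prod_lincomb_left einstein_prod_lincomb_right
        conj_transpose_lincomb)
  \<comment> \<open>Self-adjointness seen from the inverse weight: multiplying
    \<open>Y^H N = N Y\<close> by \<open>Ni\<close> on both sides moves \<open>Ni\<close> past
    \<open>Y^H\<close>.\<close>
  have Ni_swap: "?m Js Js Js Ni (conj_transpose Js Js Y) = ?m Js Js Js Y Ni"
    if "?m Js Js Js (conj_transpose Js Js Y) N = ?m Js Js Js N Y"
      "Y \<in> tensor_space (Js @ Js)" for Y
  proof -
    have "?m Js Js Js Ni (conj_transpose Js Js Y) =
        ?m Js Js Js Ni (?m Js Js Js (?m Js Js Js (conj_transpose Js Js Y) N) Ni)"
      by (simp add: assoc Ni einstein_prod_identity in_space_intros)
    also have "\<dots> = ?m Js Js Js (?m Js Js Js (?m Js Js Js Ni N) Y) Ni"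
      by (simp add: that assoc)
    finally show ?thesis by (simp add: Ni identity_einstein_prod that)
  qed
  note Ni_qH = Ni_swap[OF qHN q_sp] and Ni_BH = Ni_swap[OF BHN sp(2)]

  have qBAs: "?m Js Js Is q (?m Js Js Is B As) = As"
  proof -
    \<comment> \<open>This is the adjoint of \<open>A = A B q\<close>: transposing gives
      \<open>A^H = q^H B^H A^H\<close>, and \<open>Ni\<close> is then moved to the right past
      \<open>q^H\<close> and \<open>B^H\<close>.\<close>
    have "As = ?m Js Js Is Ni
        (?m Js Is Is (conj_transpose Is Js (?m Is Js Js A (?m Js Js Js B q))) M)"
      by (simp add: ABq As_def)
    also have "\<dots> = ?m Js Js Is (?m Js Js Js (?m Js Js Js Ni (conj_transpose Js Js q))
        (conj_transpose Js Js B)) (?m Js Is Is ?AH M)"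
      by (simp add: conj_transpose_einstein_prod assoc)
    also have "\<dots> = ?m Js Js Is (?m Js Js Js q (?m Js Js Js Ni (conj_transpose Js Js B)))
        (?m Js Is Is ?AH M)"
      by (simp add: Ni_qH assoc)
    finally show ?thesis by (simp add: Ni_BH As_def assoc)
  qed

  define X where "X = ?m Js Js Is q As"
  have XA: "?m Js Is Js X A = ?m Js Js Js B q"
    by (simp add: X_def assoc B_def[symmetric] qB)
  have "is_weighted_moore_penrose Is Js M N A X"
    unfolding is_weighted_moore_penrose_def
  proof (intro conjI)
    show "X \<in> tensor_space (Js @ Is)" by (simp add: X_def einstein_prod_in_space)
    show "?m Is Is Js (?m Is Js Is A X) A = A" by (simp add: assoc XA ABq)
    \<comment> \<open>As \<open>q\<close> and \<open>B\<close> commute,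
      \<open>X A X = B q q As\<close> becomes \<open>q (q B As)\<close>, where
      \<open>q B As = As\<close>.\<close>
    have "?m Js Js Is (?m Js Js Js B q) X = ?m Js Js Is q (?m Js Js Is B (?m Js Js Is q As))"
      by (simp add: X_def qB[symmetric] assoc)
    also have "\<dots> = ?m Js Js Is q (?m Js Js Is (?m Js Js Js B q) As)"
      by (simp add: assoc)
    also have "\<dots> = X"
      by (simp add: qB[symmetric] assoc qBAs X_def)
    finally show "?m Js Js Is (?m Js Is Js X A) X = X" by (simp add: XA)
    \<comment> \<open>With \<open>R\<close> split off, \<open>M A X = (M A) R (A^H M)\<close> has
      the form \<open>C R C^H\<close> with \<open>C = M A\<close>, so it is Hermitian once
      \<open>R\<close> is.\<close>
    define R where "R = ?m Js Js Js q Ni"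
    have MAX: "?m Is Js Is (?m Is Is Js M A) X = ?m Is Js Is (?m Is Is Js M A)
        (?m Js Js Is R (?m Js Is Is ?AH M))"
      by (simp add: X_def As_def R_def assoc)
    have "conj_transpose Js Js R = R"
      by (simp add: R_def conj_transpose_einstein_prod NiH Ni_qH)
    then show "conj_transpose Is Is (?m Is Js Is (?m Is Is Js M A) X) =
        ?m Is Js Is (?m Is Is Js M A) X"
      unfolding MAX
      by (simp add: conj_transpose_einstein_prod[of Is Is] conj_transpose_einstein_prod[of Js Is]
          conj_transpose_einstein_prod[of Is Js]
          conj_transpose_conj_transpose[OF A] MH assoc)
    have NXA: "?m Js Is Js (?m Js Js Is N X) A = ?m Js Js Js N (?m Js Js Js B q)"
      by (simp add: assoc XA)
    \<comment> \<open>\<open>B\<close> and \<open>q\<close> are self-adjoint for \<open>N\<close>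
      and commute, hence their product is self-adjoint too.\<close>
    have "conj_transpose Js Js (?m Js Js Js N (?m Js Js Js B q)) =
        ?m Js Js Js (conj_transpose Js Js q) (?m Js Js Js (conj_transpose Js Js B) N)"
      by (simp add: conj_transpose_einstein_prod NH assoc)
    also have "\<dots> = ?m Js Js Js (?m Js Js Js (conj_transpose Js Js q) N) B"
      by (simp add: BHN assoc)
    also have "\<dots> = ?m Js Js Js N (?m Js Js Js B q)"
      by (simp add: qHN assoc qB)
    finally show "conj_transpose Js Js (?m Js Is Js (?m Js Js Is N X) A) =
        ?m Js Is Js (?m Js Js Is N X) A"
      by (simp add: NXA)
  qed
  then show ?thesis by blast
qed

section \<open>Weighted self-adjointness and uniqueness\<close>

text \<open>Taking adjoints with respect to \<open>P\<close> fixes \<open>E\<close> and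
  \<open>F\<close> and reverses products, so it exchanges the two equations.\<close>

lemma self_adjoint_absorb_commute:
  assumes P: "hermitian_positive_definite Is P"
    and sp: "E \<in> tensor_space (Is @ Is)" "F \<in> tensor_space (Is @ Is)"
    and E: "einstein_prod Is Is Is (conj_transpose Is Is E) P = einstein_prod Is Is Is P E"
    and F: "einstein_prod Is Is Is (conj_transpose Is Is F) P = einstein_prod Is Is Is P F"
  shows "einstein_prod Is Is Is E F = E \<longleftrightarrow> einstein_prod Is Is Is F E = E"
proof -
  let ?m = "einstein_prod Is Is Is"
  have adjoint: "?m (conj_transpose Is Is (?m X Y)) P = ?m P (?m Y X)"
    if "?m (conj_transpose Is Is X) P = ?m P X" "?m (conj_transpose Is Is Y) P = ?m P Y" for X Y
    by (metis conj_transpose_einstein_prod einstein_prod_assoc that)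
  show ?thesis
    using adjoint[OF E F] adjoint[OF F E] E sp
      hermitian_positive_definite_left_cancel[OF P einstein_prod_in_space, of E]
    by metis
qed

text \<open>The last two Moore-Penrose equations, with the conjugate transpose distributed over the
  product with the Hermitian weight.\<close>

lemma is_weighted_moore_penrose_self_adjoint:
  assumes M: "hermitian_positive_definite Is M" and N: "hermitian_positive_definite Js N"
    and X: "is_weighted_moore_penrose Is Js M N A X"
  shows "einstein_prod Is Is Is (conj_transpose Is Is (einstein_prod Is Js Is A X)) M =
      einstein_prod Is Is Is M (einstein_prod Is Js Is A X)"
    and "einstein_prod Js Js Js (conj_transpose Js Js (einstein_prod Js Is Js X A)) N =
      einstein_prod Js Js Js N (einstein_prod Js Is Js X A)"
proof -
  have "conj_transpose Is Is (einstein_prod Is Is Is M (einstein_prod Is Js Is A X)) =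
      einstein_prod Is Is Is M (einstein_prod Is Js Is A X)"
    using X by (simp add: is_weighted_moore_penrose_def einstein_prod_assoc)
  \<comment> \<open>The transposition rule is instantiated so that it splits off only the weight
    \<open>M\<close> and leaves the conjugate transpose of \<open>A X\<close> intact.\<close>
  then show "einstein_prod Is Is Is (conj_transpose Is Is (einstein_prod Is Js Is A X)) M =
      einstein_prod Is Is Is M (einstein_prod Is Js Is A X)"
    by (simp add: conj_transpose_einstein_prod[of Is Is Is]
        hermitian_positive_definite_hermitian[OF M])
  have "conj_transpose Js Js (einstein_prod Js Js Js N (einstein_prod Js Is Js X A)) =
      einstein_prod Js Js Js N (einstein_prod Js Is Js X A)"
    using X by (simp add: is_weighted_moore_penrose_def einstein_prod_assoc)
  then show "einstein_prod Js Js Js (conj_transpose Js Js (einstein_prod Js Is Js X A)) N =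
      einstein_prod Js Js Js N (einstein_prod Js Is Js X A)"
    by (simp add: conj_transpose_einstein_prod[of Js Js Js]
        hermitian_positive_definite_hermitian[OF N])
qed

text \<open>The tensors \<open>A X\<close> and \<open>A Y\<close> absorb each other:
  \<open>A Y A X = A X\<close>, whose adjoint is \<open>A X A Y = A X\<close>, while
  \<open>A X A Y = A Y\<close>. So they agree, and likewise \<open>X A = Y A\<close>; then
  \<open>X = X A X = X A Y = Y A Y = Y\<close>.\<close>

lemma weighted_moore_penrose_unique:
  assumes M: "hermitian_positive_definite Is M" and N: "hermitian_positive_definite Js N"
    and X: "is_weighted_moore_penrose Is Js M N A X"
    and Y: "is_weighted_moore_penrose Is Js M N A Y"
  shows "X = Y"
proof -
  let ?m = einstein_prod
  have AXA: "?m Is Is Js (?m Is Js Is A X) A = A" and AYA: "?m Is Is Js (?m Is Js Is A Y) A = A"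
    and XAX: "?m Js Js Is (?m Js Is Js X A) X = X" and YAY: "?m Js Js Is (?m Js Is Js Y A) Y = Y"
    using X Y by (simp_all add: is_weighted_moore_penrose_def)
  have "?m Is Is Is (?m Is Js Is A Y) (?m Is Js Is A X) = ?m Is Js Is A X"
    by (metis AYA einstein_prod_assoc)
  then have "?m Is Is Is (?m Is Js Is A X) (?m Is Js Is A Y) = ?m Is Js Is A X"
    using self_adjoint_absorb_commute[OF M einstein_prod_in_space einstein_prod_in_space
        is_weighted_moore_penrose_self_adjoint(1)[OF M N X]
        is_weighted_moore_penrose_self_adjoint(1)[OF M N Y]] by blast
  then have AX: "?m Is Js Is A X = ?m Is Js Is A Y"
    by (metis AXA einstein_prod_assoc)
  have "?m Js Js Js (?m Js Is Js X A) (?m Js Is Js Y A) = ?m Js Is Js X A"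
    by (metis AYA einstein_prod_assoc)
  then have "?m Js Js Js (?m Js Is Js Y A) (?m Js Is Js X A) = ?m Js Is Js X A"
    using self_adjoint_absorb_commute[OF N einstein_prod_in_space einstein_prod_in_space
        is_weighted_moore_penrose_self_adjoint(2)[OF M N X]
        is_weighted_moore_penrose_self_adjoint(2)[OF M N Y]] by blast
  then have XA: "?m Js Is Js X A = ?m Js Is Js Y A"
    by (metis AXA einstein_prod_assoc)
  have "X = ?m Js Is Is X (?m Is Js Is A X)" using XAX by (simp add: einstein_prod_assoc)
  also have "\<dots> = ?m Js Js Is (?m Js Is Js X A) Y" by (simp add: AX einstein_prod_assoc)
  also have "\<dots> = Y" by (simp add: XA YAY)
  finally show ?thesis .
qed

lemma weighted_moore_penrose:
  assumes "A \<in> tensor_space (Is @ Js)"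
    and "hermitian_positive_definite Is M" and "hermitian_positive_definite Js N"
  shows "is_weighted_moore_penrose Is Js M N A (weighted_moore_penrose Is Js M N A)"
  unfolding weighted_moore_penrose_def
  using weighted_moore_penrose_exists[OF assms] weighted_moore_penrose_unique[OF assms(2,3)]
  by (metis theI)

theorem theorem3p5:
  fixes Is Js :: "nat list" and A M N :: tensor
  assumes "A \<in> tensor_space (Is @ Js)"
    and "hermitian_positive_definite Is M"
    and "hermitian_positive_definite Js N"
  shows "weighted_conj_transpose Is Is M M
           (einstein_prod Is Js Is A (weighted_moore_penrose Is Js M N A)) =
         einstein_prod Is Js Is A (weighted_moore_penrose Is Js M N A)"
proof -
  let ?E = "einstein_prod Is Js Is A (weighted_moore_penrose Is Js M N A)"
  have "weighted_conj_transpose Is Is M M ?E =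
      einstein_prod Is Is Is (tensor_inverse Is M)
        (einstein_prod Is Is Is (conj_transpose Is Is ?E) M)"
    by (simp add: weighted_conj_transpose_def einstein_prod_assoc)
  \<comment> \<open>Self-adjointness of \<open>?E\<close> with respect to \<open>M\<close> replaces
    \<open>?E^H M\<close> by \<open>M ?E\<close>, which puts \<open>M\<close> next to its
    inverse.\<close>
  also have "\<dots> = einstein_prod Is Is Is
      (einstein_prod Is Is Is (tensor_inverse Is M) M) ?E"
    unfolding is_weighted_moore_penrose_self_adjoint(1)[OF assms(2,3)
        weighted_moore_penrose[OF assms]]
    by (simp add: einstein_prod_assoc)
  also have "\<dots> = ?E"
    by (simp add: tensor_inverse(3)[OF assms(2)] identity_einstein_prod einstein_prod_in_space)
  finally show ?thesis .
qed

end
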